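(* Let $(X,\tau)$ be a non-empty topological space, let $\tau_1$ be a topology on $X$ weaker than $\tau_s$, let $I\subseteq\mathbf{R}$ be a non-empty interval, and let $f:X\times I\to\mathbf{R}$ be a function satisfying the following conditions: (1) for every $x\in X$, the function $f(x,\cdot):I\to\mathbf{R}$ is quasi-concave and continuous; (2) for every $\lambda\in I$, the function $f(\cdot,\lambda):X\to\mathbf{R}$ is $\tau_1$-lower semicontinuous and each of its $\tau_1$-local minima is a global minimum; (3) there exist a real number $\rho>\sup_{\lambda\in I}\inf_{x\in X}f(x,\lambda)$ and $\lambda_0\in I$ such that the set $\{x\in X: f(x,\lambda_0)\le\rho\}$ is sequentially $\tau$-compact. Then $$\sup_{\lambda\in I}\inf_{x\in X}f(x,\lambda)=\inf_{x\in X}\sup_{\lambda\in I}f(x,\lambda).$$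
   Context: For a topological space $(X,\tau)$, $\tau_s$ denotes the topology on $X$ whose members are the sets $A\subseteq X$ such that $X\setminus A$ is sequentially $\tau$-closed (i.e. contains every $\tau$-limit of every $\tau$-convergent sequence of its points). A topology $\tau_1$ is weaker than $\tau_s$ if $\tau_1\subseteq\tau_s$ (equality allowed). A prefix such as "$\tau_1$-" means that the notion is taken with respect to the topology $\tau_1$. A $\tau_1$-local minimum of $g:X\to\mathbf{R}$ is a point $x_0\in X$ having a $\tau_1$-neighbourhood $\Omega$ with $g(x_0)\le g(x)$ for all $x\in\Omega$; it is a global minimum if $g(x_0)\le g(x)$ for all $x\in X$. A subset is sequentially $\tau$-compact if every sequence in it has a subsequence $\tau$-converging to a point of it. A real function $\varphi$ on a convex set $C$ is quasi-concave if $\{x\in C:\varphi(x)>r\}$ is convex for every $r\in\mathbf{R}$. Suprema and infima are taken in $[-\infty,+\infty]$. *)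

theory Defs
  imports "HOL-Analysis.Analysis"
begin

definition sequentially_closedin :: "'a topology \<Rightarrow> 'a set \<Rightarrow> bool" where
  "sequentially_closedin T C \<longleftrightarrow>
     C \<subseteq> topspace T \<and>
     (\<forall>s l. (\<forall>n. s n \<in> C) \<and> limitin T s l sequentially \<longrightarrow> l \<in> C)"

lemma istopology_sequentially:
  "istopology (\<lambda>A. A \<subseteq> topspace T \<and> sequentially_closedin T (topspace T - A))"
  unfolding istopology_def
proof (intro conjI allI impI)
  fix A B
  assume A: "A \<subseteq> topspace T \<and> sequentially_closedin T (topspace T - A)"
    and B: "B \<subseteq> topspace T \<and> sequentially_closedin T (topspace T - B)"
  show "A \<inter> B \<subseteq> topspace T" using A by blast
  show "sequentially_closedin T (topspace T - A \<inter> B)"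
    unfolding sequentially_closedin_def
  proof (intro conjI allI impI)
    fix s :: "nat \<Rightarrow> 'a" and l
    assume s: "(\<forall>n. s n \<in> topspace T - A \<inter> B) \<and> limitin T s l sequentially"
    have *: "l \<in> topspace T - C"
      if C: "sequentially_closedin T (topspace T - C)" and inf: "infinite {n. s n \<notin> C}" for C
    proof -
      obtain r :: "nat \<Rightarrow> nat" where r: "strict_mono r" "\<And>n. r n \<in> {n. s n \<notin> C}"
        using infinite_enumerate[OF inf] by blast
      have "limitin T (s \<circ> r) l sequentially"
        by (rule limitin_subsequence[OF r(1)]) (use s in simp)
      moreover have "\<forall>n. (s \<circ> r) n \<in> topspace T - C"
        using s r(2) by auto
      ultimately show ?thesis
        using C unfolding sequentially_closedin_def by metis
    qed
    have "{n. s n \<notin> A} \<union> {n. s n \<notin> B} = UNIV" using s by blast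
    then have "infinite {n. s n \<notin> A} \<or> infinite {n. s n \<notin> B}"
      by (metis finite_Un infinite_UNIV_nat)
    then show "l \<in> topspace T - A \<inter> B"
    proof
      assume "infinite {n. s n \<notin> A}"
      then show ?thesis using *[of A] A by auto
    next
      assume "infinite {n. s n \<notin> B}"
      then show ?thesis using *[of B] B by auto
    qed
  qed blast
next
  fix \<K>
  assume K: "\<forall>A\<in>\<K>. A \<subseteq> topspace T \<and> sequentially_closedin T (topspace T - A)"
  show "\<Union>\<K> \<subseteq> topspace T"
    by (rule Union_least) (use K in simp)
  show "sequentially_closedin T (topspace T - \<Union>\<K>)"
    unfolding sequentially_closedin_def
  proof (intro conjI allI impI)
    show "topspace T - \<Union>\<K> \<subseteq> topspace T" by (rule Diff_subset)
  next
    fix s :: "nat \<Rightarrow> 'a" and l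
    assume s: "(\<forall>n. s n \<in> topspace T - \<Union>\<K>) \<and> limitin T s l sequentially"
    have "l \<in> topspace T" using s limitin_topspace by metis
    moreover have "l \<notin> A" if "A \<in> \<K>" for A
    proof -
      have "\<forall>n. s n \<in> topspace T - A" using s that by auto
      moreover have "sequentially_closedin T (topspace T - A)" using K that by simp
      ultimately show ?thesis
        using s unfolding sequentially_closedin_def by (metis DiffD2)
    qed
    ultimately show "l \<in> topspace T - \<Union>\<K>" by simp
  qed
qed

definition sequential_topology :: "'a topology \<Rightarrow> 'a topology" where
  "sequential_topology T =
     topology (\<lambda>A. A \<subseteq> topspace T \<and> sequentially_closedin T (topspace T - A))"

lemma openin_sequential_topology:
  "openin (sequential_topology T) A \<longleftrightarrow>
     A \<subseteq> topspace T \<and> sequentially_closedin T (topspace T - A)"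
  unfolding sequential_topology_def
  by (simp add: topology_inverse'[OF istopology_sequentially])

lemma topspace_sequential_topology: "topspace (sequential_topology T) = topspace T"
proof -
  have "openin (sequential_topology T) (topspace T)"
    by (simp add: openin_sequential_topology sequentially_closedin_def)
  then show ?thesis
    by (metis openin_sequential_topology openin_subset openin_topspace subset_antisym)
qed

definition weaker_topology :: "'a topology \<Rightarrow> 'a topology \<Rightarrow> bool" where
  "weaker_topology T1 T2 \<longleftrightarrow>
     topspace T1 = topspace T2 \<and> (\<forall>U. openin T1 U \<longrightarrow> openin T2 U)"

definition lower_semicontinuous_map :: "'a topology \<Rightarrow> ('a \<Rightarrow> real) \<Rightarrow> bool" where
  "lower_semicontinuous_map T g \<longleftrightarrow> (\<forall>r. openin T {x \<in> topspace T. r < g x})"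

definition local_minimum_in :: "'a topology \<Rightarrow> ('a \<Rightarrow> real) \<Rightarrow> 'a \<Rightarrow> bool" where
  "local_minimum_in T g x0 \<longleftrightarrow>
     (\<exists>U \<Omega>. openin T U \<and> x0 \<in> U \<and> U \<subseteq> \<Omega> \<and> \<Omega> \<subseteq> topspace T \<and> (\<forall>x\<in>\<Omega>. g x0 \<le> g x))"

definition global_minimum_on :: "'a set \<Rightarrow> ('a \<Rightarrow> real) \<Rightarrow> 'a \<Rightarrow> bool" where
  "global_minimum_on X g x0 \<longleftrightarrow> x0 \<in> X \<and> (\<forall>x\<in>X. g x0 \<le> g x)"

text \<open>The library's \<^const>\<open>seq_compact\<close> is tied to a topology given by a type class.\<close>

definition sequentially_compactin :: "'a topology \<Rightarrow> 'a set \<Rightarrow> bool" where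
  "sequentially_compactin T K \<longleftrightarrow>
     K \<subseteq> topspace T \<and>
     (\<forall>s. (\<forall>n. s n \<in> K) \<longrightarrow>
        (\<exists>l\<in>K. \<exists>r :: nat \<Rightarrow> nat. strict_mono r \<and> limitin T (s \<circ> r) l sequentially))"

definition quasi_concave_on :: "'b::real_vector set \<Rightarrow> ('b \<Rightarrow> real) \<Rightarrow> bool" where
  "quasi_concave_on C \<phi> \<longleftrightarrow> convex C \<and> (\<forall>r. convex {x \<in> C. r < \<phi> x})"

end

theory Submission
  imports Defs
begin

text \<open>Suppose the minimax equality fails and choose \<open>r \<le> \<rho>\<close> strictly between the two sides, so
  that every \<open>f(x, \<cdot>)\<close> exceeds \<open>r\<close> somewhere while every \<open>f(\<cdot>, \<mu>)\<close> drops below \<open>r\<close> somewhere.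
  By quasi-concavity, \<open>f(x, \<mu>\<^sub>0) \<le> r\<close> forces \<open>f(x, \<cdot>) \<le> r\<close> on the whole part of \<open>I\<close> to the left, or
  to the right, of \<open>\<mu>\<^sub>0\<close>. Consider the set \<open>P \<mu>\<close> of the \<open>x\<close> with \<open>f(x, \<cdot>) \<le> r\<close> on the part to the
  left of \<open>\<mu>\<close>. It shrinks as \<open>\<mu> \<ge> \<mu>\<^sub>0\<close> grows and stays inside the given sequentially compact sublevel
  set, so if it is non-empty then \<open>f(\<cdot>, \<mu>)\<close> has a minimum on it. That minimum is a local one on \<open>X\<close>,
  hence global and below \<open>r\<close>, so by continuity it still lies in \<open>P \<mu>'\<close> for some \<open>\<mu>' > \<mu>\<close>. By
  compactness the set of \<open>\<mu>\<close> with \<open>P \<mu>\<close> non-empty would have a maximum; so \<open>P \<mu>\<^sub>0\<close> is empty.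
  Reflecting \<open>I\<close>, so is its mirror image, contradicting \<open>inf f(\<cdot>, \<mu>\<^sub>0) < r\<close>.\<close>

lemma sequentially_closedin_sublevel:
  assumes "weaker_topology S (sequential_topology T)" "lower_semicontinuous_map S g"
  shows "sequentially_closedin T {x \<in> topspace T. g x \<le> c}"
proof -
  have "topspace S = topspace T"
    using assms(1) by (simp add: weaker_topology_def topspace_sequential_topology)
  then have "sequentially_closedin T (topspace T - {x \<in> topspace T. c < g x})"
    using assms unfolding weaker_topology_def lower_semicontinuous_map_def
    by (metis openin_sequential_topology)
  moreover have "topspace T - {x \<in> topspace T. c < g x} = {x \<in> topspace T. g x \<le> c}"
    by auto
  ultimately show ?thesis by simp
qed

lemma sequentially_closedin_Inter:
  assumes "\<C> \<noteq> {}" "\<And>C. C \<in> \<C> \<Longrightarrow> sequentially_closedin T C"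
  shows "sequentially_closedin T (\<Inter>\<C>)"
  using assms unfolding sequentially_closedin_def by blast

text \<open>By Lindelof, countably many of the open rays \<open>{..<c}\<close> with \<open>c\<close>
  in \<open>E\<close> already cover their union. Since \<open>E\<close> has no greatest element,
  their endpoints are cofinal in \<open>E\<close>. Running maxima then make an enumeration of them
  monotone.\<close>

lemma real_set_cofinal_sequence:
  fixes E :: "real set"
  assumes "E \<noteq> {}" and "\<And>c. c \<in> E \<Longrightarrow> \<exists>d\<in>E. c < d"
  obtains e :: "nat \<Rightarrow> real" where "incseq e" "range e \<subseteq> E" "\<And>c. c \<in> E \<Longrightarrow> \<exists>n. c \<le> e n"
proof -
  obtain \<F> where \<F>: "\<F> \<subseteq> lessThan ` E" "countable \<F>" "\<Union>\<F> = \<Union>(lessThan ` E)"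
    by (rule Lindelof[of "lessThan ` E"]) auto
  obtain D where D: "D \<subseteq> E" "countable D" "\<F> = lessThan ` D"
    using countable_subset_image[of \<F> lessThan E] \<F> by blast
  have cof: "\<exists>d\<in>D. c < d" if "c \<in> E" for c
    using assms(2)[OF that] \<F>(3) D(3) by fastforce
  then have "D \<noteq> {}" using assms(1) by blast
  then have rng: "range (from_nat_into D) = D"
    using D(2) by (rule range_from_nat_into)
  define e where "e n = Max (from_nat_into D ` {..n})" for n
  have "e n \<in> from_nat_into D ` {..n}" for n
    unfolding e_def by (intro Max_in) auto
  then have "range e \<subseteq> E" using rng D(1) by blast
  moreover have "incseq e"
    unfolding e_def by (intro monoI Max_mono image_mono) auto
  moreover have "\<exists>n. c \<le> e n" if c: "c \<in> E" for c
  proof -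
    obtain n where "c < from_nat_into D n" using cof[OF c] rng by (metis imageE)
    moreover have "from_nat_into D n \<le> e n" unfolding e_def by (intro Max_ge) auto
    ultimately show ?thesis by (intro exI[of _ n]) simp
  qed
  ultimately show thesis using that by blast
qed

text \<open>Cantor's intersection theorem survives for a chain of arbitrary size here because it is
  indexed by reals, which have countable cofinality.\<close>

lemma sequentially_compactin_chain_Inter:
  fixes E :: "real set"
  assumes K: "sequentially_compactin T K"
    and C: "\<And>c. c \<in> E \<Longrightarrow> sequentially_closedin T (C c)"
    and anti: "\<And>c d. \<lbrakk>c \<in> E; d \<in> E; c \<le> d\<rbrakk> \<Longrightarrow> C d \<subseteq> C c"
    and ne: "E \<noteq> {}" "\<And>c. c \<in> E \<Longrightarrow> K \<inter> C c \<noteq> {}"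
  shows "\<exists>x\<in>K. \<forall>c\<in>E. x \<in> C c"
proof (cases "\<exists>m\<in>E. \<forall>c\<in>E. c \<le> m")
  case True
  then show ?thesis using ne(2) anti by blast
next
  case False
  then have "\<exists>d\<in>E. c < d" if "c \<in> E" for c using that by (meson not_le)
  then obtain e :: "nat \<Rightarrow> real" where e: "incseq e" "range e \<subseteq> E" "\<And>c. c \<in> E \<Longrightarrow> \<exists>n. c \<le> e n"
    using real_set_cofinal_sequence[OF ne(1)] by metis
  have "\<exists>x. x \<in> K \<inter> C (e n)" for n using ne(2) e(2) by blast
  then obtain s where s: "\<And>n. s n \<in> K \<inter> C (e n)" by metis
  then obtain l r where l: "l \<in> K" "strict_mono r" "limitin T (s \<circ> r) l sequentially"
    using K unfolding sequentially_compactin_def by (metis IntD1)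
  have "l \<in> C c" if c: "c \<in> E" for c
  proof -
    obtain n where n: "c \<le> e n" using e(3)[OF c] by blast
    \<comment> \<open>Sequential closedness asks for every term to lie in \<open>C c\<close>, so the
      first \<open>n\<close> terms of the subsequence are dropped.\<close>
    have "((s \<circ> r) \<circ> (\<lambda>k. k + n)) k \<in> C c" for k
    proof -
      have "n \<le> r (k + n)" using seq_suble[OF l(2), of "k + n"] by linarith
      then have "c \<le> e (r (k + n))" using n incseqD[OF e(1)] by (meson order_trans)
      then show ?thesis using s[of "r (k + n)"] anti[OF c] e(2) by fastforce
    qed
    moreover have "limitin T ((s \<circ> r) \<circ> (\<lambda>k. k + n)) l sequentially"
      by (rule limitin_subsequence[OF _ l(3)]) (simp add: strict_mono_def)
    ultimately show ?thesis
      using C[OF c] unfolding sequentially_closedin_def by metis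
  qed
  then show ?thesis using l(1) by blast
qed

text \<open>This is the one-sided half of the argument; the other side follows by applying it to the
  reflected interval. The point \<open>x\<^sub>0\<close> is arbitrary: a failure at it would put it
  in \<open>P \<mu>\<^sub>0\<close>, and the set \<open>E\<close> could then be climbed without
  end.\<close>

lemma exists_greater_on_left_part:
  fixes \<tau> \<tau>\<^sub>1 :: "'a topology" and I :: "real set" and f :: "'a \<Rightarrow> real \<Rightarrow> real"
  assumes weaker: "weaker_topology \<tau>\<^sub>1 (sequential_topology \<tau>)"
    and I: "is_interval I"
    and qc: "\<And>x. x \<in> topspace \<tau> \<Longrightarrow> quasi_concave_on I (f x)"
    and cont: "\<And>x. x \<in> topspace \<tau> \<Longrightarrow> continuous_on I (f x)"
    and lsc: "\<And>\<mu>. \<mu> \<in> I \<Longrightarrow> lower_semicontinuous_map \<tau>\<^sub>1 (\<lambda>x. f x \<mu>)"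
    and locmin: "\<And>\<mu> x. \<lbrakk>\<mu> \<in> I; local_minimum_in \<tau>\<^sub>1 (\<lambda>x. f x \<mu>) x\<rbrakk> \<Longrightarrow>
          global_minimum_on (topspace \<tau>) (\<lambda>x. f x \<mu>) x"
    and \<mu>\<^sub>0: "\<mu>\<^sub>0 \<in> I"
    and K: "sequentially_compactin \<tau> {x \<in> topspace \<tau>. f x \<mu>\<^sub>0 \<le> \<rho>}"
    and r: "r \<le> \<rho>"
    and below: "\<And>\<mu>. \<mu> \<in> I \<Longrightarrow> \<exists>x\<in>topspace \<tau>. f x \<mu> < r"
    and above: "\<And>x. x \<in> topspace \<tau> \<Longrightarrow> \<exists>\<mu>\<in>I. r < f x \<mu>"
    and x\<^sub>0: "x\<^sub>0 \<in> topspace \<tau>"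
  shows "\<exists>\<mu>\<in>I. \<mu> \<le> \<mu>\<^sub>0 \<and> r < f x\<^sub>0 \<mu>"
proof (rule ccontr)
  assume contra: "\<not> ?thesis"
  define K where "K = {x \<in> topspace \<tau>. f x \<mu>\<^sub>0 \<le> \<rho>}"
  define P where "P \<mu> = {x \<in> topspace \<tau>. \<forall>\<nu>\<in>I. \<nu> \<le> \<mu> \<longrightarrow> f x \<nu> \<le> r}" for \<mu>
  define E where "E = {\<mu> \<in> I. \<mu>\<^sub>0 \<le> \<mu> \<and> P \<mu> \<noteq> {}}"
  have "x\<^sub>0 \<in> P \<mu>\<^sub>0" using contra x\<^sub>0 by (auto simp: P_def not_less)
  then have \<mu>\<^sub>0E: "\<mu>\<^sub>0 \<in> E" using \<mu>\<^sub>0 by (auto simp: E_def)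
  have top1: "topspace \<tau>\<^sub>1 = topspace \<tau>"
    using weaker by (simp add: weaker_topology_def topspace_sequential_topology)
  have sublevel: "sequentially_closedin \<tau> {x \<in> topspace \<tau>. f x \<mu> \<le> c}" if "\<mu> \<in> I" for \<mu> c
    using sequentially_closedin_sublevel[OF weaker lsc[OF that]] .
  have Pclosed: "sequentially_closedin \<tau> (P \<mu>)" if "\<mu> \<in> I" for \<mu>
  proof -
    have "P \<mu> = \<Inter>((\<lambda>\<nu>. {x \<in> topspace \<tau>. f x \<nu> \<le> r}) ` {\<nu> \<in> I. \<nu> \<le> \<mu>})"
      using that by (auto simp: P_def)
    moreover have "sequentially_closedin \<tau> \<dots>"
      by (rule sequentially_closedin_Inter) (use that sublevel in auto)
    ultimately show ?thesis by simp
  qed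
  have PK: "P \<mu> \<subseteq> K" if "\<mu>\<^sub>0 \<le> \<mu>" for \<mu>
    using that \<mu>\<^sub>0 r by (force simp: P_def K_def)
  have between: "r < f x \<nu>"
    if "x \<in> topspace \<tau>" "a \<in> I" "b \<in> I" "r < f x a" "r < f x b" "a \<le> \<nu>" "\<nu> \<le> b" for x a b \<nu>
  proof -
    have "is_interval {\<mu> \<in> I. r < f x \<mu>}"
      using qc[OF that(1)] by (simp add: quasi_concave_on_def is_interval_convex_1)
    from mem_is_interval_1_I[OF this, of a b \<nu>] show ?thesis using that by auto
  qed
  have step: "\<exists>\<mu>'\<in>E. \<mu> < \<mu>'" if \<mu>: "\<mu> \<in> E" for \<mu>
  proof -
    have \<mu>I: "\<mu> \<in> I" "\<mu>\<^sub>0 \<le> \<mu>" and ne: "P \<mu> \<noteq> {}" using \<mu> by (auto simp: E_def)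
    \<comment> \<open>A common point of the sublevel sets at all attained values is a minimizer on
      \<open>P \<mu>\<close>. Values are negated so that the sets shrink as the index grows.\<close>
    have "\<exists>x\<in>K. \<forall>c\<in>(\<lambda>y. - f y \<mu>) ` P \<mu>. x \<in> P \<mu> \<inter> {x \<in> topspace \<tau>. f x \<mu> \<le> - c}"
    proof (rule sequentially_compactin_chain_Inter)
      show "sequentially_compactin \<tau> K" using K by (simp add: K_def)
      show "sequentially_closedin \<tau> (P \<mu> \<inter> {x \<in> topspace \<tau>. f x \<mu> \<le> - c})" for c
        using sequentially_closedin_Inter[of "{P \<mu>, {x \<in> topspace \<tau>. f x \<mu> \<le> - c}}" \<tau>]
          Pclosed sublevel \<mu>I by auto
      show "(\<lambda>y. - f y \<mu>) ` P \<mu> \<noteq> {}" using ne by blast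
    qed (use PK[OF \<mu>I(2)] in \<open>fastforce simp: P_def\<close>)+
    then obtain x where x: "x \<in> P \<mu>" and min: "\<And>y. y \<in> P \<mu> \<Longrightarrow> f x \<mu> \<le> f y \<mu>"
      using ne by auto
    have xX: "x \<in> topspace \<tau>" using x by (simp add: P_def)
    obtain \<nu> where \<nu>: "\<nu> \<in> I" "r < f x \<nu>" using above[OF xX] by blast
    have "\<mu> < \<nu>" using x \<nu> by (force simp: P_def not_less[symmetric])
    \<comment> \<open>On this neighbourhood of \<open>x\<close>, a point outside
      \<open>P \<mu>\<close> exceeds \<open>r\<close> on both sides of \<mu>, hence at \<mu>, where
      \<open>x\<close> does not. So minimality on \<open>P \<mu>\<close> extends to all of
      \<open>U\<close>.\<close>
    define U where "U = {y \<in> topspace \<tau>. r < f y \<nu>}"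
    have "openin \<tau>\<^sub>1 U" using lsc[OF \<nu>(1)] top1 by (simp add: U_def lower_semicontinuous_map_def)
    moreover have "f x \<mu> \<le> f y \<mu>" if "y \<in> U" for y
    proof (cases "y \<in> P \<mu>")
      case False
      have "y \<in> topspace \<tau>" using that by (simp add: U_def)
      then obtain \<kappa> where "\<kappa> \<in> I" "\<kappa> \<le> \<mu>" "r < f y \<kappa>"
        using False by (auto simp: P_def not_le)
      then have "r < f y \<mu>" using between[of y \<kappa> \<nu> \<mu>] that \<nu>(1) \<open>\<mu> < \<nu>\<close> by (simp add: U_def)
      then show ?thesis using x \<mu>I by (force simp: P_def)
    qed (rule min)
    moreover have "x \<in> U" using xX \<nu> by (simp add: U_def)
    moreover have "U \<subseteq> topspace \<tau>\<^sub>1" using top1 by (auto simp: U_def)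
    ultimately have "local_minimum_in \<tau>\<^sub>1 (\<lambda>x. f x \<mu>) x"
      unfolding local_minimum_in_def by blast
    then have "global_minimum_on (topspace \<tau>) (\<lambda>x. f x \<mu>) x"
      using locmin \<mu>I by blast
    then have "f x \<mu> < r"
      using below[OF \<mu>I(1)] unfolding global_minimum_on_def by fastforce
    then obtain d where d: "d > 0" "\<And>\<kappa>. \<lbrakk>\<kappa> \<in> I; \<bar>\<kappa> - \<mu>\<bar> < d\<rbrakk> \<Longrightarrow> \<bar>f x \<kappa> - f x \<mu>\<bar> < r - f x \<mu>"
      using cont[OF xX] \<mu>I(1) unfolding continuous_on_iff dist_real_def
      by (metis diff_gt_0_iff_gt)
    \<comment> \<open>The cap \<nu> keeps \<open>\<mu>'\<close> in \<open>I\<close>; moreover, a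
      value above \<open>r\<close> to the left of \<open>\<mu>'\<close>, together with the one at
      \<nu>, would force \<open>r < f x \<mu>'\<close>.\<close>
    define \<mu>' where "\<mu>' = min \<nu> (\<mu> + d/2)"
    have \<mu>': "\<mu> < \<mu>'" "\<mu>' \<le> \<nu>" "\<bar>\<mu>' - \<mu>\<bar> < d" using d(1) \<open>\<mu> < \<nu>\<close> by (auto simp: \<mu>'_def)
    have "\<mu>' \<in> I" using mem_is_interval_1_I[OF I \<mu>I(1) \<nu>(1)] \<mu>' by simp
    then have "f x \<mu>' < r" using d(2) \<mu>' by fastforce
    have "x \<in> P \<mu>'"
      using between[of x _ \<nu> \<mu>'] xX \<nu> \<mu>' \<open>f x \<mu>' < r\<close> by (force simp: P_def not_less[symmetric])
    then show ?thesis using \<open>\<mu>' \<in> I\<close> \<mu>' \<mu>I by (auto simp: E_def)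
  qed
  \<comment> \<open>The sets \<open>P \<mu>\<close> themselves now form the chain. A parameter where
    their common point exceeds \<open>r\<close> bounds \<open>E\<close> above.\<close>
  have "\<exists>x\<in>K. \<forall>\<mu>\<in>E. x \<in> P \<mu>"
  proof (rule sequentially_compactin_chain_Inter)
    show "sequentially_compactin \<tau> K" using K by (simp add: K_def)
    show "E \<noteq> {}" using \<mu>\<^sub>0E by blast
    show "K \<inter> P \<mu> \<noteq> {}" if "\<mu> \<in> E" for \<mu> using that PK by (auto simp: E_def)
  qed (use Pclosed in \<open>auto simp: E_def P_def\<close>)
  then obtain x where xX: "x \<in> topspace \<tau>" and x: "\<And>\<mu>. \<mu> \<in> E \<Longrightarrow> x \<in> P \<mu>"
    by (auto simp: K_def)
  obtain \<nu> where \<nu>: "\<nu> \<in> I" "r < f x \<nu>" using above[OF xX] by blast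
  have bound: "\<mu> \<le> \<nu>" if "\<mu> \<in> E" for \<mu> using x[OF that] \<nu> by (force simp: P_def)
  then have bdd: "bdd_above E" by (auto simp: bdd_above_def)
  define b where "b = Sup E"
  have upper: "\<mu> \<le> b" if "\<mu> \<in> E" for \<mu> unfolding b_def using cSup_upper[OF that bdd] .
  have "b \<le> \<nu>" unfolding b_def using \<mu>\<^sub>0E bound by (intro cSup_least) auto
  then have bI: "b \<in> I" using mem_is_interval_1_I[OF I \<mu>\<^sub>0 \<nu>(1)] upper[OF \<mu>\<^sub>0E] by simp
  \<comment> \<open>Membership in \<open>P \<mu>\<close> for all \<mu> in \<open>E\<close> controls
    \<open>f x\<close> only strictly below \<open>b\<close> when the supremum is not attained;
    continuity supplies \<open>b\<close> itself.\<close>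
  have "f x b \<le> r"
  proof (rule ccontr)
    assume "\<not> f x b \<le> r"
    then obtain d where d: "d > 0" "\<And>\<kappa>. \<lbrakk>\<kappa> \<in> I; \<bar>\<kappa> - b\<bar> < d\<rbrakk> \<Longrightarrow> \<bar>f x \<kappa> - f x b\<bar> < f x b - r"
      using cont[OF xX] bI unfolding continuous_on_iff dist_real_def
      by (metis diff_gt_0_iff_gt not_le)
    obtain e where e: "e \<in> E" "b - d < e"
      using less_cSupD[of E "b - d"] \<mu>\<^sub>0E d(1) by (auto simp: b_def)
    have "f x e \<le> r" using x[OF e(1)] e(1) by (auto simp: P_def E_def)
    moreover have "e \<in> I" "\<bar>e - b\<bar> < d" using e upper[OF e(1)] by (auto simp: E_def)
    ultimately show False using d(2)[of e] by linarith
  qed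
  moreover have "f x \<kappa> \<le> r" if \<kappa>: "\<kappa> \<in> I" "\<kappa> < b" for \<kappa>
  proof -
    obtain e where "e \<in> E" "\<kappa> < e"
      using less_cSupD[of E \<kappa>] \<mu>\<^sub>0E \<kappa>(2) by (auto simp: b_def)
    then show ?thesis using x[of e] \<kappa> by (auto simp: P_def)
  qed
  ultimately have "x \<in> P b" using xX by (auto simp: P_def le_less)
  then have "b \<in> E" using bI upper[OF \<mu>\<^sub>0E] by (auto simp: E_def)
  then show False using step upper by fastforce
qed

text \<open>Negation is an involution, so preservation of convexity in one direction gives
  both.\<close>

lemma convex_reflect_iff: "convex (uminus ` S) \<longleftrightarrow> convex S" for S :: "'b::real_vector set"
  using convex_negations[of S] convex_negations[of "uminus ` S"] by (auto simp: image_image)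

theorem theorem1:
  fixes \<tau> \<tau>\<^sub>1 :: "'a topology"
    and I :: "real set"
    and f :: "'a \<Rightarrow> real \<Rightarrow> real"
  assumes "topspace \<tau> \<noteq> {}"
    and "weaker_topology \<tau>\<^sub>1 (sequential_topology \<tau>)"
    and "is_interval I" and "I \<noteq> {}"
    and "\<And>x. x \<in> topspace \<tau> \<Longrightarrow> quasi_concave_on I (f x) \<and> continuous_on I (f x)"
    and "\<And>\<mu>. \<mu> \<in> I \<Longrightarrow> lower_semicontinuous_map \<tau>\<^sub>1 (\<lambda>x. f x \<mu>) \<and>
           (\<forall>x\<^sub>0. local_minimum_in \<tau>\<^sub>1 (\<lambda>x. f x \<mu>) x\<^sub>0 \<longrightarrow>
                  global_minimum_on (topspace \<tau>) (\<lambda>x. f x \<mu>) x\<^sub>0)"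
    and "\<exists>\<rho>::real. \<exists>\<mu>\<^sub>0\<in>I.
           ereal \<rho> > (SUP \<mu>\<in>I. INF x\<in>topspace \<tau>. ereal (f x \<mu>)) \<and>
           sequentially_compactin \<tau> {x \<in> topspace \<tau>. f x \<mu>\<^sub>0 \<le> \<rho>}"
  shows "(SUP \<mu>\<in>I. INF x\<in>topspace \<tau>. ereal (f x \<mu>)) =
         (INF x\<in>topspace \<tau>. SUP \<mu>\<in>I. ereal (f x \<mu>))"
proof (rule antisym)
  show "(SUP \<mu>\<in>I. INF x\<in>topspace \<tau>. ereal (f x \<mu>)) \<le>
        (INF x\<in>topspace \<tau>. SUP \<mu>\<in>I. ereal (f x \<mu>))"
    by (intro SUP_least INF_greatest) (metis INF_lower SUP_upper order_trans)
next
  let ?S = "SUP \<mu>\<in>I. INF x\<in>topspace \<tau>. ereal (f x \<mu>)"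
  let ?J = "INF x\<in>topspace \<tau>. SUP \<mu>\<in>I. ereal (f x \<mu>)"
  show "?J \<le> ?S"
  proof (rule ccontr)
    assume "\<not> ?J \<le> ?S"
    obtain \<rho> \<mu>\<^sub>0 where \<mu>\<^sub>0: "\<mu>\<^sub>0 \<in> I" and \<rho>: "?S < ereal \<rho>"
      and K: "sequentially_compactin \<tau> {x \<in> topspace \<tau>. f x \<mu>\<^sub>0 \<le> \<rho>}"
      using assms(7) by blast
    have "?S < min ?J (ereal \<rho>)" using \<open>\<not> ?J \<le> ?S\<close> \<rho> by simp
    then obtain r where r: "?S < ereal r" "ereal r < min ?J (ereal \<rho>)"
      using ereal_dense2 by blast
    have below: "\<exists>x\<in>topspace \<tau>. f x \<mu> < r" if "\<mu> \<in> I" for \<mu>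
    proof -
      have "(INF x\<in>topspace \<tau>. ereal (f x \<mu>)) < ereal r"
        using SUP_upper[OF that] r(1) by (rule le_less_trans)
      then show ?thesis by (simp add: INF_less_iff)
    qed
    have above: "\<exists>\<mu>\<in>I. r < f x \<mu>" if "x \<in> topspace \<tau>" for x
    proof -
      have "ereal r < ?J" using r(2) by simp
      also have "\<dots> \<le> (SUP \<mu>\<in>I. ereal (f x \<mu>))" using that by (rule INF_lower)
      finally show ?thesis by (simp add: less_SUP_iff)
    qed
    obtain x where x: "x \<in> topspace \<tau>" "f x \<mu>\<^sub>0 < r" using below[OF \<mu>\<^sub>0] by blast
    have "\<exists>\<mu>\<in>I. \<mu> \<le> \<mu>\<^sub>0 \<and> r < f x \<mu>"
      using exists_greater_on_left_part[of \<tau>\<^sub>1 \<tau> I f \<mu>\<^sub>0 \<rho> r x] assms(2,3,5,6) \<mu>\<^sub>0 K r(2) below above x(1)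
      by simp
    then obtain a where a: "a \<in> I" "a \<le> \<mu>\<^sub>0" "r < f x a" by blast
    \<comment> \<open>Reversing the sign of the parameter swaps left and right and preserves all
      hypotheses.\<close>
    have "\<exists>\<mu>\<in>uminus ` I. \<mu> \<le> - \<mu>\<^sub>0 \<and> r < f x (- \<mu>)"
    proof (rule exists_greater_on_left_part[where \<rho> = \<rho> and f = "\<lambda>x \<mu>. f x (- \<mu>)"])
      show "is_interval (uminus ` I)"
        using assms(3) by (simp add: is_interval_convex_1 convex_reflect_iff)
      show "quasi_concave_on (uminus ` I) (\<lambda>\<mu>. f y (- \<mu>))" if "y \<in> topspace \<tau>" for y
      proof -
        have "{\<mu> \<in> uminus ` I. s < f y (- \<mu>)} = uminus ` {\<mu> \<in> I. s < f y \<mu>}" for s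
          by auto
        then show ?thesis
          using assms(5)[OF that] by (simp add: quasi_concave_on_def convex_reflect_iff)
      qed
      show "continuous_on (uminus ` I) (\<lambda>\<mu>. f y (- \<mu>))" if "y \<in> topspace \<tau>" for y
        by (rule continuous_on_compose2[of I "f y"])
          (use assms(5)[OF that] in \<open>auto intro: continuous_intros\<close>)
    qed (use assms(2,6) \<mu>\<^sub>0 K r(2) below above x(1) in auto)
    then obtain b where b: "b \<in> I" "\<mu>\<^sub>0 \<le> b" "r < f x b" by auto
    \<comment> \<open>The same \<open>x\<close> exceeds \<open>r\<close> at \<open>a\<close> and at
      \<open>b\<close>, which enclose \<open>\<mu>\<^sub>0\<close>, against
      \<open>f x \<mu>\<^sub>0 < r\<close>.\<close>
    have "is_interval {\<mu> \<in> I. r < f x \<mu>}"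
      using assms(5)[OF x(1)] by (simp add: quasi_concave_on_def is_interval_convex_1)
    from mem_is_interval_1_I[OF this, of a b \<mu>\<^sub>0] show False using a b x(2) by auto
  qed
qed

end
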